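(* Let $n,k$ be natural numbers with $k\le n$, $p$ a prime and $q=p^r$ for some positive integer $r$, and write $\mathbb{F}_q=\{0,\alpha_1,\dots,\alpha_{q-1}\}$. Then $$S_{\mathbb{F}_q}(\boldsymbol{e}_{n,k})=\sum_{\boldsymbol{\lambda}\dashv_q n} \binom{n}{\boldsymbol{\lambda}} \sum_{\boldsymbol{\gamma}\in \mathrm{Sym}(\boldsymbol{\lambda})} \exp\left(\frac{2\pi i}{p} \mathrm{Tr}_{\mathbb{F}_q/\mathbb{F}_p}\big(\Lambda_{\alpha_1,\dots, \alpha_{q-1}}(k,\boldsymbol{\gamma}^* )\big)\right).$$
   Context: $\boldsymbol{e}_{n,k}=\sum_{1\le i_1<\dots<i_k\le n}X_{i_1}\cdots X_{i_k}$. $S_{\mathbb{F}_q}(F)=\sum_{\mathbf{x}\in\mathbb{F}_q^n}\exp\!\big(\tfrac{2\pi i}{p}\mathrm{Tr}_{\mathbb{F}_q/\mathbb{F}_p}(F(\mathbf{x}))\big)$, with $\mathrm{Tr}_{\mathbb{F}_q/\mathbb{F}_p}(\alpha)=\sum_{j=0}^{r-1}\alpha^{p^j}\in\mathbb{F}_p=\{0,\dots,p-1\}$. $\boldsymbol{\lambda}\dashv_q n$ means $\boldsymbol{\lambda}=(\lambda_1,\dots,\lambda_s)$ is an integer partition of $n$ ($\lambda_1\ge\dots\ge\lambda_s\ge1$, $\sum\lambda_i=n$) with $s\le q$ parts, viewed as a list of length $q$ by right-padding with zeros. $\binom{n}{\boldsymbol{\lambda}}$ is the multinomial coefficient $n!/(\lambda_1!\cdots\lambda_q!)$.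 $\mathrm{Sym}(\boldsymbol{\lambda})$ is the set of all distinct rearrangements (permutations of entries) of the length-$q$ list $\boldsymbol{\lambda}$. For a list $\boldsymbol{\gamma}$, $\boldsymbol{\gamma}^*$ is the list obtained by removing its first element (so $\boldsymbol{\gamma}^*$ has $q-1$ entries, used as $m_1,\dots,m_{q-1}$). For $a_1,a_2,\dots\in\mathbb{F}_q$, an integer $k$ and nonnegative integers $m_i$: $\Lambda_{a_1}(k,m)=a_1^k\binom{m}{k}$ (taken to be $0$ if $k<0$ or $k>m$; $a^0=1$), and recursively $\Lambda_{a_1,\dots,a_{l+1}}(k,m_1,\dots,m_{l+1})=\sum_{j=0}^{m_{l+1}}\binom{m_{l+1}}{j}a_{l+1}^j\Lambda_{a_1,\dots,a_l}(k-j,m_1,\dots,m_l)$. *)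

theory Defs
  imports
    Complex_Main
    "HOL-Library.FuncSet"
    "HOL-Library.Poly_Mapping"
    "HOL-Combinatorics.Multiset_Permutations"
    "HOL-Computational_Algebra.Primes"
begin

(* Polynomials in the variables mvar 1, mvar 2, ...: finitely supported maps from monomials
   (exponent vectors) to coefficients; multiplication is the convolution product. *)
type_synonym 'a mpoly = "(nat \<Rightarrow>\<^sub>0 nat) \<Rightarrow>\<^sub>0 'a"

definition mvar :: "nat \<Rightarrow> 'a::comm_semiring_1 mpoly" where
  "mvar i = Poly_Mapping.single (Poly_Mapping.single i 1) 1"

definition eval_mpoly :: "'a::comm_semiring_1 mpoly \<Rightarrow> (nat \<Rightarrow> 'a) \<Rightarrow> 'a" where
  "eval_mpoly F x =
     (\<Sum>m\<in>Poly_Mapping.keys F. Poly_Mapping.lookup F m *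
        (\<Prod>i\<in>Poly_Mapping.keys m. x i ^ Poly_Mapping.lookup m i))"

definition elem_sym :: "nat \<Rightarrow> nat \<Rightarrow> 'a::comm_semiring_1 mpoly" where
  "elem_sym n k = (\<Sum>I\<in>{I. I \<subseteq> {1..n} \<and> card I = k}. \<Prod>i\<in>I. mvar i)"

definition ff_trace :: "nat \<Rightarrow> nat \<Rightarrow> 'a::finite_field \<Rightarrow> 'a" where
  "ff_trace p r y = (\<Sum>j<r. y ^ (p ^ j))"

(* The prime field {0, ..., p - 1} sits inside the field of characteristic p via of_nat;
   this is the representative of an element z of the prime field. *)
definition fp_rep :: "nat \<Rightarrow> 'a::finite_field \<Rightarrow> nat" where
  "fp_rep p z = (THE t. t < p \<and> of_nat t = z)"

definition add_char :: "nat \<Rightarrow> nat \<Rightarrow> 'a::finite_field \<Rightarrow> complex" where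
  "add_char p r y = exp (2 * of_real pi * \<i> / of_nat p * of_nat (fp_rep p (ff_trace p r y)))"

(* F is regarded as a polynomial in mvar 1, ..., mvar n. *)
definition exp_sum :: "nat \<Rightarrow> nat \<Rightarrow> nat \<Rightarrow> 'a::finite_field mpoly \<Rightarrow> complex" where
  "exp_sum p r n F = (\<Sum>x\<in>{1..n} \<rightarrow>\<^sub>E (UNIV :: 'a set). add_char p r (eval_mpoly F x))"

definition partitions_padded :: "nat \<Rightarrow> nat \<Rightarrow> nat list set" where
  "partitions_padded q n =
     {lam @ replicate (q - length lam) 0 | lam.
        sorted_wrt (\<ge>) lam \<and> (\<forall>v\<in>set lam. v \<ge> 1) \<and> sum_list lam = n \<and> length lam \<le> q}"

definition multinomial :: "nat \<Rightarrow> nat list \<Rightarrow> complex" where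
  "multinomial n lam = fact n / (\<Prod>v\<leftarrow>lam. fact v)"

definition rearrangements :: "nat list \<Rightarrow> nat list set" where
  "rearrangements lam = permutations_of_multiset (mset lam)"

(* Lambda_upto as ms l uses the first l + 1 entries of as and ms; list positions start at 0,
   so as ! l is the paper's a_(l+1). *)
primrec Lambda_upto :: "'a::comm_semiring_1 list \<Rightarrow> nat list \<Rightarrow> nat \<Rightarrow> int \<Rightarrow> 'a" where
  "Lambda_upto as ms 0 k =
     (if 0 \<le> k \<and> k \<le> int (ms ! 0)
      then (as ! 0) ^ nat k * of_nat ((ms ! 0) choose nat k) else 0)"
| "Lambda_upto as ms (Suc l) k =
     (\<Sum>j = 0..ms ! Suc l.
        of_nat ((ms ! Suc l) choose j) * (as ! Suc l) ^ j * Lambda_upto as ms l (k - int j))"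

(* Only meaningful for nonempty as and ms of equal length. *)
definition Lambda :: "'a::comm_semiring_1 list \<Rightarrow> int \<Rightarrow> nat list \<Rightarrow> 'a" where
  "Lambda as k ms = Lambda_upto as ms (length as - 1) k"

end

theory Submission
  imports Defs "HOL-Computational_Algebra.Polynomial"
begin

text \<open>The value of the elementary symmetric polynomial at a point \<open>x\<close> is the \<open>k\<close>-th coefficient of
  \<open>\<Prod>\<^sub>i (1 + x\<^sub>i T)\<close>. Grouping equal factors turns this product into
  \<open>\<Prod>\<^sub>v (1 + v T)\<^bsup>m v\<^esup>\<close>, where \<open>m v\<close> counts the coordinates equal to \<open>v\<close>, and the \<open>k\<close>-th
  coefficient of the latter is \<open>\<Lambda>\<close>; the value \<open>v = 0\<close> contributes the factor 1, which is why the
  first entry of \<open>\<gamma>\<close> is dropped. So the summand only depends on the list \<open>\<gamma>\<close> of multiplicities, the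
  number of points with multiplicities \<open>\<gamma>\<close> is a multinomial coefficient, and the possible \<open>\<gamma>\<close>
  are classified by their decreasing rearrangements.\<close>

section \<open>Elementary symmetric polynomials as coefficients of a product of linear
  factors\<close>

lemma eval_mpoly_add: "eval_mpoly (F + G) x = eval_mpoly F x + eval_mpoly G x"
  unfolding eval_mpoly_def
  \<comment> \<open>Coefficients can cancel, so the keys of \<open>F + G\<close> need not be the
    union of those of \<open>F\<close> and \<open>G\<close>; the rule applies because the summand is
    additive in the coefficient and 0 at coefficient 0.\<close>
  by (rule setsum_keys_plus_distrib) (simp_all add: distrib_right)

lemma eval_mpoly_sum: "eval_mpoly (\<Sum>i\<in>A. F i) x = (\<Sum>i\<in>A. eval_mpoly (F i) x)"
proof (induction A rule: infinite_finite_induct)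
  case (insert i A)
  then show ?case by (simp add: eval_mpoly_add)
qed (simp_all add: eval_mpoly_def)

lemma prod_mvar:
  "(\<Prod>i\<in>I. mvar i :: 'a::comm_semiring_1 mpoly) =
    Poly_Mapping.single (\<Sum>i\<in>I. Poly_Mapping.single i 1) 1"
  by (induction I rule: infinite_finite_induct) (simp_all add: mvar_def mult_single)

lemma lookup_sum_single:
  assumes "finite I"
  shows "Poly_Mapping.lookup (\<Sum>i\<in>I. Poly_Mapping.single i (1::nat)) j = (if j \<in> I then 1 else 0)"
  using assms by (simp add: lookup_sum lookup_single when_def)

text \<open>The product is a single monomial with coefficient 1 and exponent 1 exactly at the
  elements of \<open>I\<close>, so the evaluation has one term.\<close>

lemma eval_mpoly_prod_mvar:
  assumes "finite I"
  shows "eval_mpoly (\<Prod>i\<in>I. mvar i) x = (\<Prod>i\<in>I. x i)"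
proof -
  have "Poly_Mapping.keys (\<Sum>i\<in>I. Poly_Mapping.single i (1::nat)) = I"
    using assms by (auto simp: in_keys_iff lookup_sum_single simp del: One_nat_def split: if_splits)
  then show ?thesis
    using assms unfolding prod_mvar eval_mpoly_def by (simp add: lookup_sum_single del: One_nat_def)
qed

text \<open>Expanding the product takes from each factor either 1 or the linear term; the set
  \<open>I\<close> of factors supplying the linear term gives a monomial of degree
  \<open>card I\<close>.\<close>

lemma coeff_prod_linear:
  fixes x :: "'b \<Rightarrow> 'a::comm_semiring_1"
  assumes "finite A"
  shows "coeff (\<Prod>i\<in>A. [:1, x i:]) k = (\<Sum>I\<in>{I. I \<subseteq> A \<and> card I = k}. \<Prod>i\<in>I. x i)"
proof -
  have prod_monom: "(\<Prod>i\<in>I. monom (x i) 1) = monom (\<Prod>i\<in>I. x i) (card I)" for I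
    by (induction I rule: infinite_finite_induct) (simp_all add: mult_monom)
  have "(\<Prod>i\<in>A. [:1, x i:]) = (\<Prod>i\<in>A. monom (x i) 1 + 1)"
    by (intro prod.cong) (simp_all add: monom_altdef one_pCons)
  also have "\<dots> = (\<Sum>I\<in>Pow A. monom (\<Prod>i\<in>I. x i) (card I))"
    by (subst prod_add[OF assms]) (simp add: prod_monom del: One_nat_def)
  finally have "coeff (\<Prod>i\<in>A. [:1, x i:]) k =
      (\<Sum>I\<in>Pow A. if card I = k then \<Prod>i\<in>I. x i else 0)"
    by (simp add: coeff_sum)
  also have "\<dots> = (\<Sum>I\<in>{I. I \<subseteq> A \<and> card I = k}. \<Prod>i\<in>I. x i)"
    using assms by (intro sum.mono_neutral_cong_right) auto
  finally show ?thesis .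
qed

lemma eval_elem_sym:
  "eval_mpoly (elem_sym n k) x = coeff (\<Prod>i\<in>{1..n}. [:1, x i:]) k"
  unfolding elem_sym_def eval_mpoly_sum coeff_prod_linear[OF finite_atLeastAtMost]
  by (intro sum.cong refl eval_mpoly_prod_mvar) (auto intro: finite_subset)

section \<open>\<open>Lambda\<close> as a coefficient of a product of powers\<close>

lemma coeff_one_linear_power:
  "coeff ([:1, a:] ^ m) i = of_nat (m choose i) * (a::'a::comm_semiring_1) ^ i"
proof (cases "i \<le> m")
  case True
  then show ?thesis by (simp add: coeff_linear_poly_power)
next
  case False
  have "degree ([:1, a:] ^ m) \<le> degree [:1, a:] * m" by (rule degree_power_le)
  also have "\<dots> \<le> 1 * m" by (intro mult_right_mono) auto
  finally have "degree ([:1, a:] ^ m) < i" using False by simp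
  then show ?thesis using False by (simp add: coeff_eq_0 binomial_eq_0)
qed

text \<open>The recursion is the convolution rule for multiplying by the power of the next linear
  factor. Negative \<open>k\<close> must be covered because \<open>k - int j\<close> can drop below
  0.\<close>

lemma Lambda_upto_eq_coeff:
  "Lambda_upto as ms l k =
    (if k < 0 then 0 else coeff (\<Prod>j\<le>l. [:1, as ! j:] ^ (ms ! j)) (nat k))"
proof (induction l arbitrary: k)
  case 0
  then show ?case
    by (auto simp: coeff_one_linear_power binomial_eq_0 mult.commute)
next
  case (Suc l)
  let ?P = "\<Prod>j\<le>l. [:1, as ! j:] ^ (ms ! j)"
  let ?a = "as ! Suc l" and ?m = "ms ! Suc l"
  show ?case
  proof (cases "k < 0")
    case True
    then show ?thesis by (simp add: Suc.IH)
  next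
    case False
    \<comment> \<open>Terms with \<open>j > nat k\<close> vanish by the induction hypothesis and
      those with \<open>j > ?m\<close> by the binomial coefficient, so both ranges reduce to their
      intersection.\<close>
    have "(\<Sum>j = 0..?m. of_nat (?m choose j) * ?a ^ j * Lambda_upto as ms l (k - int j)) =
        (\<Sum>j\<in>{..?m} \<inter> {..nat k}. of_nat (?m choose j) * ?a ^ j * coeff ?P (nat k - j))"
      using False
      by (intro sum.mono_neutral_cong_right) (auto simp: Suc.IH nat_diff_distrib')
    also have "\<dots> = (\<Sum>j\<le>nat k. of_nat (?m choose j) * ?a ^ j * coeff ?P (nat k - j))"
      by (intro sum.mono_neutral_left) (auto simp: binomial_eq_0 intro!: leI)
    also have "\<dots> = coeff ([:1, ?a:] ^ ?m * ?P) (nat k)"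
      by (simp add: coeff_mult coeff_one_linear_power)
    finally show ?thesis using False by (simp add: mult.commute)
  qed
qed

lemma Lambda_eq_coeff:
  assumes "as \<noteq> []"
  shows "Lambda as (int k) ms = coeff (\<Prod>j<length as. [:1, as ! j:] ^ (ms ! j)) k"
proof -
  \<comment> \<open>For an empty list the truncated \<open>length as - 1\<close> would give
    \<open>{..0}\<close> instead of the empty set.\<close>
  have "{..length as - 1} = {..<length as}"
    using assms by (cases as) auto
  then show ?thesis by (simp add: Lambda_def Lambda_upto_eq_coeff)
qed

text \<open>Absent values have exponent 0, so the product extends to the whole type; the factor at 0
  is a power of \<open>[:1, 0:] = 1\<close>, which leaves the values in \<open>as\<close>.\<close>

lemma prod_mset_linear_eq:
  fixes as :: "'a::{comm_semiring_1,finite} list"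
  assumes "distinct (0 # as)" "set (0 # as) = UNIV"
  shows "(\<Prod>v\<in>#M. [:1, v:]) = (\<Prod>j<length as. [:1, as ! j:] ^ count M (as ! j))"
proof -
  have "(\<Prod>v\<in>#M. [:1, v:]) = (\<Prod>v\<in>set_mset M. [:1, v:] ^ count M v)"
    by (rule image_prod_mset_multiplicity)
  also have "\<dots> = (\<Prod>v\<in>UNIV. [:1, v:] ^ count M v)"
    by (intro prod.mono_neutral_left) (auto simp: not_in_iff)
  also have "\<dots> = (\<Prod>v\<in>set as. [:1, v:] ^ count M v)"
    unfolding assms(2)[symmetric] using assms(1) by (simp flip: one_pCons)
  also have "\<dots> = (\<Prod>v\<leftarrow>as. [:1, v:] ^ count M v)"
    using assms(1) by (simp add: prod.distinct_set_conv_list)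
  also have "\<dots> = (\<Prod>j<length as. [:1, as ! j:] ^ count M (as ! j))"
    by (simp add: prod.list_conv_set_nth atLeast0LessThan)
  finally show ?thesis .
qed

section \<open>Counting points by the multiplicities of their coordinates\<close>

lemma bij_betw_PiE_lists:
  "bij_betw (\<lambda>x. map x [1..<Suc n]) ({1..n} \<rightarrow>\<^sub>E (UNIV :: 'a set)) {xs. length xs = n}"
\<comment> \<open>Coordinate \<open>i\<close> sits at list position \<open>i - 1\<close>; the
  restriction supplies the value \<open>undefined\<close> that extensionality requires outside
  \<open>{1..n}\<close>.\<close>
proof (rule bij_betw_byWitness[where f' = "\<lambda>xs. \<lambda>i\<in>{1..n}. xs ! (i - 1)"])
  show "\<forall>x\<in>{1..n} \<rightarrow>\<^sub>E (UNIV :: 'a set). (\<lambda>i\<in>{1..n}. map x [1..<Suc n] ! (i - 1)) = x"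
    by (auto simp: fun_eq_iff restrict_def PiE_def extensional_def simp del: upt_Suc)
  show "\<forall>xs\<in>{xs :: 'a list. length xs = n}.
      map (\<lambda>i\<in>{1..n}. xs ! (i - 1)) [1..<Suc n] = xs"
    by (auto intro!: nth_equalityI simp del: upt_Suc)
qed auto

text \<open>As \<open>vs\<close> lists every value once, \<gamma> determines the multiset of
  \<open>xs\<close>, so the fibre consists of the permutations of one multiset
  \<open>M\<close>.\<close>

lemma count_vec_fibre:
  fixes vs :: "'a list"
  assumes "distinct vs" "set vs = UNIV"
    and "length \<gamma> = length vs" "sum_list \<gamma> = n"
  shows "of_nat (card {xs. length xs = n \<and> map (count (mset xs)) vs = \<gamma>}) = multinomial n \<gamma>"
proof -
  define M where "M = (\<Sum>i<length vs. replicate_mset (\<gamma> ! i) (vs ! i))"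
  have cnt: "count M (vs ! i) = \<gamma> ! i" if "i < length vs" for i
  proof -
    have "count M (vs ! i) = (\<Sum>j<length vs. if j = i then \<gamma> ! j else 0)"
      unfolding M_def count_sum using that assms(1)
      by (intro sum.cong) (auto simp: nth_eq_iff_index_eq)
    then show ?thesis using that by simp
  qed
  have map_M: "map (count M) vs = \<gamma>"
    using assms(3) by (intro nth_equalityI) (auto simp: cnt)
  have size_M: "size M = n"
    unfolding M_def using assms(3,4)
    by (simp add: size_multiset_sum sum_list_sum_nth atLeast0LessThan)
  have "map (count (mset xs)) vs = \<gamma> \<longleftrightarrow> mset xs = M" for xs
    using assms(2) map_M by (auto simp: multiset_eq_iff simp flip: map_M)
  then have "{xs. length xs = n \<and> map (count (mset xs)) vs = \<gamma>} = permutations_of_multiset M"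
    using size_M by (auto simp: permutations_of_multiset_def simp flip: size_mset)
  moreover have "(\<Prod>v\<in>set_mset M. fact (count M v)) = (\<Prod>m\<leftarrow>\<gamma>. fact m :: nat)"
  proof -
    \<comment> \<open>Values outside \<open>M\<close> contribute \<open>fact 0 = 1\<close>.\<close>
    have "(\<Prod>v\<in>set_mset M. fact (count M v) :: nat) = (\<Prod>v\<in>set vs. fact (count M v))"
      using finite_set[of vs, unfolded assms(2)]
      by (intro prod.mono_neutral_left) (auto simp: not_in_iff assms(2))
    also have "\<dots> = (\<Prod>m\<leftarrow>map (count M) vs. fact m)"
      using assms(1) by (simp add: prod.distinct_set_conv_list o_def)
    finally show ?thesis by (simp only: map_M)
  qed
  ultimately have "card {xs. length xs = n \<and> map (count (mset xs)) vs = \<gamma>} * (\<Prod>m\<leftarrow>\<gamma>. fact m) = fact n"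
    using card_permutations_of_multiset_aux[of M] size_M by simp
  then have "complex_of_nat (card {xs. length xs = n \<and> map (count (mset xs)) vs = \<gamma>} *
      (\<Prod>m\<leftarrow>\<gamma>. fact m)) = of_nat (fact n)"
    by (rule arg_cong)
  moreover have "of_nat (\<Prod>m\<leftarrow>\<gamma>. fact m) = (\<Prod>m\<leftarrow>\<gamma>. fact m :: complex)"
    by (induction \<gamma>) simp_all
  moreover have "(\<Prod>m\<leftarrow>\<gamma>. fact m :: complex) \<noteq> 0"
    by (auto simp: prod_list_zero_iff)
  ultimately show ?thesis
    by (simp add: multinomial_def field_simps)
qed

lemma finite_compositions: "finite {\<gamma> :: nat list. length \<gamma> = q \<and> sum_list \<gamma> = n}"
proof (rule finite_subset)
  show "{\<gamma> :: nat list. length \<gamma> = q \<and> sum_list \<gamma> = n} \<subseteq> {\<gamma>. set \<gamma> \<subseteq> {..n} \<and> length \<gamma> = q}"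
    by (auto intro: member_le_sum_list)
qed (simp add: finite_lists_length_eq)

text \<open>The sum is grouped by the vector of multiplicities, on which the summand is constant;
  \<open>count_vec_fibre\<close> gives the size of each group.\<close>

lemma sum_lists_by_count:
  fixes vs :: "'a list" and f :: "nat list \<Rightarrow> complex"
  assumes "distinct vs" "set vs = UNIV"
  shows "(\<Sum>xs\<in>{xs. length xs = n}. f (map (count (mset xs)) vs)) =
    (\<Sum>\<gamma>\<in>{\<gamma>. length \<gamma> = length vs \<and> sum_list \<gamma> = n}. multinomial n \<gamma> * f \<gamma>)"
proof -
  let ?S = "{xs :: 'a list. length xs = n}" and ?g = "\<lambda>xs. map (count (mset xs)) vs"
  let ?G = "{\<gamma>. length \<gamma> = length vs \<and> sum_list \<gamma> = n}"
  have fin: "finite ?S"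
    using finite_lists_length_eq[of "UNIV :: 'a set" n] finite_set[of vs] assms(2) by simp
  have "sum_list (?g xs) = length xs" for xs
  proof -
    have "sum_list (?g xs) = (\<Sum>v\<in>UNIV. count (mset xs) v)"
      using assms by (simp add: sum.distinct_set_conv_list flip: assms(2))
    also have "\<dots> = (\<Sum>v\<in>set xs. count (mset xs) v)"
      using finite_set[of vs] assms(2)
      by (intro sum.mono_neutral_right) (auto simp: count_eq_zero_iff)
    also have "\<dots> = length xs"
      by (metis set_mset_mset size_mset size_multiset_overloaded_eq)
    finally show ?thesis .
  qed
  then have "?g ` ?S \<subseteq> ?G" by auto
  then have "(\<Sum>xs\<in>?S. f (?g xs)) = (\<Sum>\<gamma>\<in>?G. \<Sum>xs\<in>{xs\<in>?S. ?g xs = \<gamma>}. f (?g xs))"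
    by (intro sum.group[symmetric] fin finite_compositions)
  also have "\<dots> = (\<Sum>\<gamma>\<in>?G. multinomial n \<gamma> * f \<gamma>)"
    using count_vec_fibre[OF assms, of _ n] by (intro sum.cong) auto
  finally show ?thesis .
qed

section \<open>Compositions grouped by their decreasing rearrangement\<close>

lemma partitions_padded_iff:
  "lam \<in> partitions_padded q n \<longleftrightarrow>
    length lam = q \<and> sum_list lam = n \<and> sorted_wrt (\<ge>) lam" (is "?L \<longleftrightarrow> ?R")
proof
  assume ?L
  then show ?R
    by (auto simp: partitions_padded_def sorted_wrt_append sum_list_replicate
        sorted_wrt_iff_nth_less nth_append)
next
  assume R: ?R
  define mu where "mu = takeWhile (\<lambda>v. v \<ge> 1) lam"
  \<comment> \<open>After its first zero a decreasing list of naturals has only zeros, so what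
    follows the positive prefix is exactly the padding.\<close>
  have "sorted_wrt (\<ge>) lam \<Longrightarrow>
    dropWhile (\<lambda>v. v \<ge> 1) lam = replicate (length lam - length (takeWhile (\<lambda>v. v \<ge> 1) lam)) 0"
    for lam :: "nat list"
    by (induction lam) (auto simp: intro!: replicate_eqI[symmetric] replicate_eqI)
  then have split: "lam = mu @ replicate (q - length mu) 0"
    unfolding mu_def using R by (metis takeWhile_dropWhile_id)
  moreover have "sorted_wrt (\<ge>) mu"
    using R split by (metis sorted_wrt_append)
  moreover have "sum_list mu = n"
    using R arg_cong[OF split, of sum_list] by (simp add: sum_list_replicate)
  moreover have "\<forall>v\<in>set mu. v \<ge> 1"
    unfolding mu_def by (auto dest: set_takeWhileD)
  moreover have "length mu \<le> q"
    using R unfolding mu_def by (auto simp: length_takeWhile_le)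
  ultimately show ?L unfolding partitions_padded_def by blast
qed

text \<open>Every composition has exactly one decreasing rearrangement, so the fibres of sorting are
  the sets \<open>rearrangements lam\<close>.\<close>

lemma sum_compositions_by_partition:
  fixes h :: "nat list \<Rightarrow> complex"
  shows "(\<Sum>\<gamma>\<in>{\<gamma>. length \<gamma> = q \<and> sum_list \<gamma> = n}. h \<gamma>) =
    (\<Sum>lam\<in>partitions_padded q n. \<Sum>\<gamma>\<in>rearrangements lam. h \<gamma>)"
proof -
  let ?G = "{\<gamma>. length \<gamma> = q \<and> sum_list \<gamma> = n}" and ?g = "\<lambda>\<gamma> :: nat list. rev (sort \<gamma>)"
  have sorted: "sorted_wrt (\<ge>) (?g \<gamma>)" for \<gamma>
    by (simp add: sorted_wrt_rev)
  have sum: "sum_list (?g \<gamma>) = sum_list \<gamma>" for \<gamma>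
    by (metis mset_rev mset_sort sum_mset_sum_list)
  have "finite (partitions_padded q n)"
    by (rule finite_subset[OF _ finite_compositions[of q n]]) (auto simp: partitions_padded_iff)
  moreover have "?g ` ?G \<subseteq> partitions_padded q n"
    by (auto simp: partitions_padded_iff sorted sum simp del: sum_list_rev)
  ultimately have "(\<Sum>\<gamma>\<in>?G. h \<gamma>) = (\<Sum>lam\<in>partitions_padded q n. \<Sum>\<gamma>\<in>{\<gamma>\<in>?G. ?g \<gamma> = lam}. h \<gamma>)"
    by (intro sum.group[symmetric] finite_compositions)
  moreover have "{\<gamma>\<in>?G. ?g \<gamma> = lam} = rearrangements lam"
    if "lam \<in> partitions_padded q n" for lam
  proof -
    have "sorted (rev lam)"
      using that by (simp add: partitions_padded_iff sorted_wrt_rev)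
    \<comment> \<open>A sorted list is determined by its multiset.\<close>
    then have "?g \<gamma> = lam \<longleftrightarrow> mset \<gamma> = mset lam" for \<gamma>
      by (metis mset_rev mset_sort properties_for_sort rev_rev_ident)
    moreover have "\<gamma> \<in> ?G" if "mset \<gamma> = mset lam" for \<gamma>
      using that \<open>lam \<in> partitions_padded q n\<close>
      by (metis (mono_tags, lifting) mem_Collect_eq mset_eq_length partitions_padded_iff
          sum_mset_sum_list)
    ultimately show ?thesis
      unfolding rearrangements_def permutations_of_multiset_def by blast
  qed
  ultimately show ?thesis by simp
qed

text \<open>Lets the coefficient be factored out of the inner sum over rearrangements.\<close>

lemma multinomial_rearrangements:
  assumes "\<gamma> \<in> rearrangements lam"
  shows "multinomial n \<gamma> = multinomial n lam"
proof -
  have "mset (map fact \<gamma>) = mset (map fact lam :: complex list)"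
    using assms by (simp add: rearrangements_def permutations_of_multiset_def)
  then show ?thesis
    unfolding multinomial_def by (metis prod_mset_prod_list)
qed

theorem theorem3p4:
  fixes n k p r q :: nat
    and \<alpha>s :: "'a::finite_field list"
  assumes "k \<le> n"
    and "prime p"
    and "r > 0"
    and "q = p ^ r"
    and "card (UNIV :: 'a set) = q"
    and "distinct (0 # \<alpha>s)"
    and "set (0 # \<alpha>s) = UNIV"
  shows "exp_sum p r n (elem_sym n k :: 'a mpoly) =
    (\<Sum>lam\<in>partitions_padded q n. multinomial n lam *
       (\<Sum>\<gamma>\<in>rearrangements lam. add_char p r (Lambda \<alpha>s (int k) (tl \<gamma>))))"
proof -
  let ?vs = "0 # \<alpha>s" and ?f = "\<lambda>\<gamma>. add_char p r (Lambda \<alpha>s (int k) (tl \<gamma>))"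
  \<comment> \<open>Since 1 differs from 0, it must occur in \<open>\<alpha>s\<close>.\<close>
  have "1 \<in> set ?vs" using assms(7) by simp
  then have ne: "\<alpha>s \<noteq> []" by auto
  have len: "length ?vs = q"
    using distinct_card[OF assms(6)] assms(5,7) by simp
  \<comment> \<open>Listing 0 first in \<open>?vs\<close> puts its multiplicity at the head, where
    \<open>tl\<close> removes it.\<close>
  have eval: "eval_mpoly (elem_sym n k) x =
      Lambda \<alpha>s (int k) (tl (map (count (mset (map x [1..<Suc n]))) ?vs))" for x :: "nat \<Rightarrow> 'a"
  proof -
    have "(\<Prod>i\<in>{1..n}. [:1, x i:]) = (\<Prod>v\<in>#mset (map x [1..<Suc n]). [:1, v:])"
      using prod.distinct_set_conv_list[of "[1..<Suc n]" "\<lambda>i. [:1, x i:]"]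
      by (simp add: prod_mset_prod_list o_def atLeastLessThanSuc_atLeastAtMost
          flip: mset_map del: upt_Suc)
    then show ?thesis
      by (simp add: eval_elem_sym Lambda_eq_coeff[OF ne] prod_mset_linear_eq[OF assms(6,7)]
          del: upt_Suc)
  qed
  have "exp_sum p r n (elem_sym n k :: 'a mpoly) =
      (\<Sum>xs\<in>{xs. length xs = n}. ?f (map (count (mset xs)) ?vs))"
    unfolding exp_sum_def eval by (rule sum.reindex_bij_betw[OF bij_betw_PiE_lists])
  also have "\<dots> = (\<Sum>\<gamma>\<in>{\<gamma>. length \<gamma> = q \<and> sum_list \<gamma> = n}. multinomial n \<gamma> * ?f \<gamma>)"
    using sum_lists_by_count[OF assms(6,7), of ?f n] unfolding len .
  also have "\<dots> = (\<Sum>lam\<in>partitions_padded q n. \<Sum>\<gamma>\<in>rearrangements lam. multinomial n \<gamma> * ?f \<gamma>)"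
    by (rule sum_compositions_by_partition)
  also have "\<dots> = (\<Sum>lam\<in>partitions_padded q n. multinomial n lam *
       (\<Sum>\<gamma>\<in>rearrangements lam. ?f \<gamma>))"
    by (simp add: sum_distrib_left multinomial_rearrangements)
  finally show ?thesis .
qed

end
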